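(* Let $X = Y$ and $S$ be completely regular topological spaces, let $\pi^{+} \in \mathcal M_{+}(X \times S)$ and $\pi^{-}\in \mathcal M_{+}(Y \times S)$ be nonnegative Radon measures, and let $c \colon S \to \mathbb R$ be a positive Borel measurable cost function. Then the maximum in the optimal exchange problem is attained, that is, there exists an optimal measure $\gamma^{*} \in \Gamma(\pi^{+}, \pi^{-}, c)$: $$\int_{X \times Y \times S} c(s)\, d\gamma^{*} \ge \int_{X \times Y \times S} c(s)\, d\gamma \quad \text{for all } \gamma \in \Gamma(\pi^{+}, \pi^{-}, c).$$
   Context: For a topological space $Z$, $\mathcal M_{+}(Z)$ denotes the set of (finite) nonnegative Radon measures on $Z$: Borel measures $\mu$ such that for every Borel set $B$ and every $\varepsilon>0$ there is a compact set $K\subset B$ with $\mu(B\setminus K)<\varepsilon$. For a measure $\gamma$ on $X\times Y\times S$, $Pr_{X\times S}(\gamma)$ and $Pr_{Y\times S}(\gamma)$ denote its projections (image measures under the coordinate projections) on the indicated factors. Inequalities between measures are setwise on Borel sets. Here $Y$ is a copy of $X$. $\Gamma(\pi^{+}, \pi^{-}, c)$ is the set of all $\gamma \in \mathcal M_{+}(X \times Y \times S)$ such that $Pr_{X \times S}(\gamma) \le \pi^{+}$, $Pr_{Y \times S}(\gamma) \le \pi^{-}$, and the balance condition "$\int_{Y \times S} c(s)\, d\gamma = \int_{X \times S} c(s)\, d\gamma$" holds; the latter is an equality of measures on $X=Y$, i.e. for every Borel set $A\subset X$, $$\int_{A\times Y\times S} c(s)\,d\gamma=\int_{X\times A\times S}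 c(s)\,d\gamma .$$ The optimal exchange problem is to maximize $\int_{X \times Y \times S} c(s)\, d\gamma$ over $\gamma\in\Gamma(\pi^{+}, \pi^{-}, c)$.
   Formalization: The formal theorem additionally assumes that the cost c is integrable with respect to at least one of π⁺ and π⁻ (automatic for bounded c); without such an assumption the maximum need not be attained. *)

theory Defs
  imports "HOL-Analysis.Analysis"
begin

text \<open>
  Finite nonnegative Radon measures. The requirement that \<open>K\<close> be Borel is automatic in
  Hausdorff spaces. It is needed in general, because \<open>measure M (B - K)\<close> is \<open>0\<close> by
  convention when \<open>B - K\<close> is not measurable.
\<close>

definition radon_measures :: "'a::topological_space measure set" where
  "radon_measures = {M. sets M = sets borel \<and> finite_measure M \<and>
     (\<forall>B\<in>sets borel. \<forall>e>0. \<exists>K. compact K \<and> K \<in> sets borel \<and> K \<subseteq> B \<and> measure M (B - K) < e)}"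

definition proj_XS :: "('x::topological_space \<times> 'x \<times> 's::topological_space) measure \<Rightarrow> ('x \<times> 's) measure" where
  "proj_XS \<gamma> = distr \<gamma> borel (\<lambda>(x, y, s). (x, s))"

definition proj_YS :: "('x::topological_space \<times> 'x \<times> 's::topological_space) measure \<Rightarrow> ('x \<times> 's) measure" where
  "proj_YS \<gamma> = distr \<gamma> borel (\<lambda>(x, y, s). (y, s))"

text \<open>
  The domination of measures is written out setwise, since the library order on the type
  of measures is a lexicographic one. Integrals of the positive cost take values in
  \<open>[0, \<infinity>]\<close>.
\<close>

definition exchange_plans ::
  "('x::topological_space \<times> 's::topological_space) measure \<Rightarrow> ('x \<times> 's) measure \<Rightarrow> ('s \<Rightarrow> real)
    \<Rightarrow> ('x \<times> 'x \<times> 's) measure set" where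
  "exchange_plans \<pi>p \<pi>m c = {\<gamma> \<in> radon_measures.
     (\<forall>B\<in>sets borel. emeasure (proj_XS \<gamma>) B \<le> emeasure \<pi>p B) \<and>
     (\<forall>B\<in>sets borel. emeasure (proj_YS \<gamma>) B \<le> emeasure \<pi>m B) \<and>
     (\<forall>A\<in>sets borel.
        (\<integral>\<^sup>+\<omega>\<in>A \<times> UNIV \<times> UNIV. ennreal (c (snd (snd \<omega>))) \<partial>\<gamma>) =
        (\<integral>\<^sup>+\<omega>\<in>UNIV \<times> A \<times> UNIV. ennreal (c (snd (snd \<omega>))) \<partial>\<gamma>))}"

definition exchange_value ::
  "('s \<Rightarrow> real) \<Rightarrow> ('x::topological_space \<times> 'x \<times> 's::topological_space) measure \<Rightarrow> ennreal" where
  "exchange_value c \<gamma> = (\<integral>\<^sup>+\<omega>. ennreal (c (snd (snd \<omega>))) \<partial>\<gamma>)"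

end

theory Submission
  imports Defs
begin

text \<open>
  Take plans whose values increase to the supremum and, by Tychonoff, a subfilter of the sequence
  along which they converge setwise to a finitely additive \<open>\<nu>\<close> on the Borel sets. The marginals of
  \<open>\<nu>\<close> are dominated by the Radon measures \<open>\<pi>p\<close> and \<open>\<pi>m\<close>, so \<open>\<nu>\<close> is tight, and the inner content of
  \<open>\<nu>\<close> on compact sets generates a Radon measure \<open>\<gamma>\<close> with the same mass and \<open>\<gamma> U \<le> \<nu> U\<close> on open
  sets. Only on sets pulled back from one of the two marginals are \<open>\<gamma>\<close> and \<open>\<nu>\<close> equal (by outer
  regularity of \<open>\<pi>p\<close> and \<open>\<pi>m\<close>), but this suffices: domination, balance and value depend on the
  marginals alone, and setwise convergence with domination carries over to integrals of the
  merely measurable cost.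
\<close>

section \<open>Radon measures on regular spaces\<close>

text \<open>Compactness upgrades the separation of points from closed sets to a separation of
  \<open>K\<close> from \<open>- U\<close>; \<open>W\<close> is the complement of the neighbourhood
  found for \<open>- U\<close>.\<close>

lemma regular_compact_between:
  fixes K U :: "'a::topological_space set"
  assumes "regular_space (euclidean :: 'a topology)" "compact K" "open U" "K \<subseteq> U"
  obtains V W where "open V" "closed W" "K \<subseteq> V" "V \<subseteq> W" "W \<subseteq> U"
proof -
  have "compactin euclidean K" "closedin euclidean (- U)" "disjnt K (- U)"
    using assms by (auto simp: disjnt_def)
  from regular_space_compact_closed_separation[OF assms(1) this]
  obtain V V' where "open V" "open V'" "K \<subseteq> V" "- U \<subseteq> V'" "disjnt V V'"
    by auto
  then show thesis
    by (intro that[of V "- V'"]) (auto simp: disjnt_def)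
qed

text \<open>The part of \<open>K\<close> outside \<open>U\<close> has an open neighbourhood
  \<open>W\<close> trapped in a closed subset \<open>C\<close> of \<open>V\<close>, and
  \<open>K - W\<close> and \<open>K \<inter> C\<close> are the pieces. They may overlap, so the
  splitting serves subadditivity. Closedness is carried along because compact sets need not be
  closed without the Hausdorff property.\<close>

lemma regular_compact_split:
  fixes K U V :: "'a::topological_space set"
  assumes "regular_space (euclidean :: 'a topology)" "compact K" "closed K"
    and "open U" "open V" "K \<subseteq> U \<union> V"
  obtains K1 K2 where "compact K1" "closed K1" "K1 \<subseteq> U" "compact K2" "closed K2" "K2 \<subseteq> V"
    "K = K1 \<union> K2"
proof -
  have "compact (K - U)" "K - U \<subseteq> V"
    using assms by (auto intro: compact_diff)
  then obtain W C where "open W" "closed C" "K - U \<subseteq> W" "W \<subseteq> C" "C \<subseteq> V"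
    using regular_compact_between[OF assms(1) _ assms(5)] by metis
  show thesis
  proof (rule that[of "K - W" "K \<inter> C"])
    show "compact (K - W)" "compact (K \<inter> C)" "closed (K - W)" "closed (K \<inter> C)"
      using assms \<open>open W\<close> \<open>closed C\<close> by (simp_all add: compact_diff compact_Int_closed closed_Diff closed_Int)
    show "K - W \<subseteq> U" "K \<inter> C \<subseteq> V" "K = K - W \<union> K \<inter> C"
      using \<open>K - U \<subseteq> W\<close> \<open>W \<subseteq> C\<close> \<open>C \<subseteq> V\<close> by blast+
  qed
qed

text \<open>The sets that do not separate \<open>x\<close> from \<open>y\<close> form a
  sigma-algebra, so agreement on open sets propagates to all Borel sets.\<close>

lemma borel_indistinguishable:
  fixes B :: "'a::topological_space set"
  assumes "B \<in> sets borel" and "\<And>U. open U \<Longrightarrow> x \<in> U \<longleftrightarrow> y \<in> U"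
  shows "x \<in> B \<longleftrightarrow> y \<in> B"
proof -
  have "B \<in> sigma_sets UNIV {S. open S}"
    using assms(1) by (simp add: borel_def)
  then show ?thesis
  proof induction
    case (Basic a)
    then show ?case using assms(2)[of a] by simp
  qed auto
qed

text \<open>Without the Hausdorff property: a Borel set does not separate topologically
  indistinguishable points, and regularity separates all others by open sets.\<close>

lemma regular_borel_compact_closed:
  fixes K :: "'a::topological_space set"
  assumes reg: "regular_space (euclidean :: 'a topology)" and "compact K" and "K \<in> sets borel"
  shows "closed K"
proof -
  have "\<exists>T. open T \<and> x \<in> T \<and> T \<subseteq> - K" if "x \<notin> K" for x
  proof -
    have disj: "K \<inter> closure {x} = {}"
    proof (rule ccontr)
      assume "K \<inter> closure {x} \<noteq> {}"
      then obtain k where k: "k \<in> K" "k \<in> closure {x}" by auto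
      have "k \<in> U \<longleftrightarrow> x \<in> U" if U: "open U" for U
      proof
        assume "k \<in> U"
        then show "x \<in> U"
          using k(2) U open_Int_closure_eq_empty[of U "{x}"] by auto
      next
        assume "x \<in> U"
        \<comment> \<open>A closed \<open>W\<close> with \<open>x\<close> inside and contained in
          \<open>U\<close> also contains the closure of \<open>{x}\<close>, hence
          \<open>k\<close>.\<close>
        then obtain V W where "open V" "closed W" "{x} \<subseteq> V" "V \<subseteq> W" "W \<subseteq> U"
          by - (rule regular_compact_between[OF reg _ U, of "{x}"], simp_all)
        then show "k \<in> U"
          using k(2) closure_minimal[of "{x}" W] by blast
      qed
      then have "k \<in> K \<longleftrightarrow> x \<in> K" by (rule borel_indistinguishable[OF assms(3)])
      with k(1) \<open>x \<notin> K\<close> show False by simp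
    qed
    \<comment> \<open>Since \<open>K\<close> misses \<open>closure {x}\<close>, a closed set can be
      fitted around \<open>K\<close> inside the complement of that closure; its own complement is
      the desired neighbourhood of \<open>x\<close>.\<close>
    obtain V W where "open V" "closed W" "K \<subseteq> V" "V \<subseteq> W" "W \<subseteq> - closure {x}"
      by (rule regular_compact_between[OF reg assms(2), of "- closure {x}"]) (use disj in auto)
    then have "open (- W)" "x \<in> - W" "- W \<subseteq> - K"
      using closure_subset[of "{x}"] by auto
    then show ?thesis by blast
  qed
  then show ?thesis
    unfolding closed_def open_subopen[of "- K"] by simp
qed

text \<open>Inner regularity applied to \<open>- B\<close>: the approximating compact set is Borel,
  hence closed, so its complement is an open superset of \<open>B\<close>.\<close>

lemma radon_measures_outer_regular:
  fixes M :: "'a::topological_space measure"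
  assumes reg: "regular_space (euclidean :: 'a topology)" and M: "M \<in> radon_measures"
    and B: "B \<in> sets borel" and "e > 0"
  obtains U where "open U" "B \<subseteq> U" "measure M (U - B) < e"
proof -
  have "- B \<in> sets borel" using B by auto
  then obtain K where K: "compact K" "K \<in> sets borel" "K \<subseteq> - B" "measure M (- B - K) < e"
    using M \<open>e > 0\<close> unfolding radon_measures_def by blast
  have "- B - K = - K - B" by auto
  then show thesis
    using K regular_borel_compact_closed[OF reg K(1,2)] by (intro that[of "- K"]) auto
qed

lemma radon_measures_tight:
  fixes M :: "'a::topological_space measure"
  assumes reg: "regular_space (euclidean :: 'a topology)" and M: "M \<in> radon_measures" and "e > 0"
  obtains K where "compact K" "closed K" "measure M (- K) < e"
proof -
  have "\<forall>B\<in>sets borel. \<forall>e>0. \<exists>K. compact K \<and> K \<in> sets borel \<and> K \<subseteq> B \<and> measure M (B - K) < e"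
    using M by (simp add: radon_measures_def)
  then obtain K where K: "compact K" "K \<in> sets borel" "measure M (UNIV - K) < e"
    using \<open>e > 0\<close> by (meson sets.top space_borel UNIV_I borel_open open_UNIV)
  then show thesis
    using regular_borel_compact_closed[OF reg K(1,2)] by (intro that[of K]) (auto simp: Compl_eq_Diff_UNIV)
qed

text \<open>A Caratheodory construction starting from a merely finitely additive \<nu>. Compactness
  supplies the countable subadditivity that \<nu> may lack, regularity lets compact sets be split
  along open covers, and tightness ensures that no mass is lost. The result may differ from \<nu>,
  but it keeps the total mass and stays below \<nu> on open sets.\<close>

lemma radon_measure_of_content:
  fixes \<nu> :: "'a::topological_space set \<Rightarrow> ennreal"
  assumes reg: "regular_space (euclidean :: 'a topology)"
    and pos: "positive (sets borel) \<nu>" and add: "additive (sets borel) \<nu>"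
    and fin: "\<nu> UNIV < \<infinity>"
    and tight: "\<And>e. 0 < e \<Longrightarrow> \<exists>K. compact K \<and> closed K \<and> \<nu> (- K) < ennreal e"
  obtains \<gamma> where "\<gamma> \<in> radon_measures" "emeasure \<gamma> UNIV = \<nu> UNIV"
    "\<And>U. open U \<Longrightarrow> emeasure \<gamma> U \<le> \<nu> U"
proof -
  interpret borel: sigma_algebra UNIV "sets (borel :: 'a measure)"
    using sets.sigma_algebra_axioms[of "borel :: 'a measure"] by simp
  have mono: "\<nu> A \<le> \<nu> B" if "A \<subseteq> B" "A \<in> sets borel" "B \<in> sets borel" for A B
    using increasingD[OF borel.additive_increasing[OF pos add]] that by blast
  have sub: "\<nu> (A \<union> B) \<le> \<nu> A + \<nu> B" if "A \<in> sets borel" "B \<in> sets borel" for A B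
  proof -
    have "\<nu> (A \<union> (B - A)) = \<nu> A + \<nu> (B - A)"
      using that by (intro additiveD[OF add]) auto
    also have "\<dots> \<le> \<nu> A + \<nu> B"
      using that by (intro add_left_mono mono) auto
    finally show ?thesis by simp
  qed
  \<comment> \<open>Inner approximation uses compact sets that are also closed, so that they are
    Borel and the additivity of \<nu> applies. \<open>\<kappa>\<close> is the inner content, used on
    open sets, and \<open>\<mu>\<close> its outer extension.\<close>
  define \<K> where "\<K> U = {K. compact K \<and> closed K \<and> K \<subseteq> U}" for U :: "'a set"
  define \<kappa> where "\<kappa> U = (SUP K\<in>\<K> U. \<nu> K)" for U
  define \<mu> where "\<mu> E = (INF U\<in>{U. open U \<and> E \<subseteq> U}. \<kappa> U)" for E
  have \<kappa>_upper: "\<nu> K \<le> \<kappa> U" if "compact K" "closed K" "K \<subseteq> U" for K U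
    unfolding \<kappa>_def \<K>_def using that by (intro SUP_upper) auto
  have \<kappa>_mono: "\<kappa> U \<le> \<kappa> V" if "U \<subseteq> V" for U V
    unfolding \<kappa>_def by (rule SUP_subset_mono) (use that in \<open>auto simp: \<K>_def\<close>)
  have \<kappa>_le: "\<kappa> U \<le> \<nu> U" if "open U" for U
    unfolding \<kappa>_def \<K>_def using that by (intro SUP_least mono) auto
  have \<kappa>_empty: "\<kappa> {} = 0"
    using \<kappa>_le[of "{}"] pos by (simp add: positive_def)
  have \<kappa>_fin: "\<kappa> U < \<infinity>" for U
    using \<kappa>_mono[of U UNIV] \<kappa>_le[of UNIV] fin by (auto intro: le_less_trans)
  have \<kappa>_approx: "\<exists>K. compact K \<and> closed K \<and> K \<subseteq> U \<and> \<kappa> U < \<nu> K + ennreal e" if "e > 0" for U e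
  proof -
    have "{} \<in> \<K> U" by (simp add: \<K>_def)
    then have "\<K> U \<noteq> {}" by blast
    from SUP_approx_ennreal[OF that this \<kappa>_def] \<kappa>_fin[of U] show ?thesis
      by (auto simp: \<K>_def)
  qed
  have \<mu>_open: "\<mu> U = \<kappa> U" if "open U" for U
    unfolding \<mu>_def using that by (intro antisym INF_lower INF_greatest \<kappa>_mono) auto
  have \<mu>_upper: "\<mu> E \<le> \<kappa> U" if "open U" "E \<subseteq> U" for E U
    unfolding \<mu>_def using that by (intro INF_lower) auto
  have \<mu>_mono: "\<mu> E \<le> \<mu> F" if "E \<subseteq> F" for E F
    unfolding \<mu>_def by (rule INF_superset_mono) (use that in auto)
  have finite_cover: "\<nu> K \<le> (\<Sum>i<n. \<kappa> (U i))"
    if "compact K" "closed K" "\<And>i. open (U i)" "K \<subseteq> (\<Union>i<n. U i)"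
    for n K and U :: "nat \<Rightarrow> 'a set"
    using that
  proof (induction n arbitrary: K)
    case 0
    then show ?case using pos by (simp add: positive_def)
  next
    \<comment> \<open>Split \<open>K\<close> between the first \<open>n\<close> open sets and the
      last one; the induction hypothesis covers the first piece and the definition of
      \<open>\<kappa>\<close> the second.\<close>
    case (Suc n)
    have "K \<subseteq> (\<Union>i<n. U i) \<union> U n"
      using Suc.prems(4) by (simp add: lessThan_Suc Un_commute)
    moreover have "open (\<Union>i<n. U i)"
      using Suc.prems(3) by blast
    ultimately obtain K1 K2 where K: "compact K1" "closed K1" "K1 \<subseteq> (\<Union>i<n. U i)"
      "compact K2" "closed K2" "K2 \<subseteq> U n" "K = K1 \<union> K2"
      using regular_compact_split[OF reg Suc.prems(1,2) _ Suc.prems(3)] by metis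
    have "\<nu> K \<le> \<nu> K1 + \<nu> K2"
      unfolding K(7) using K by (intro sub) auto
    also have "\<dots> \<le> (\<Sum>i<n. \<kappa> (U i)) + \<kappa> (U n)"
      using K by (intro add_mono Suc.IH Suc.prems(3) \<kappa>_upper)
    finally show ?case by simp
  qed
  \<comment> \<open>Each competing \<open>K\<close> is compact and meets only finitely many
    \<open>U i\<close> in a subcover, so finite subadditivity already yields the countable
    one.\<close>
  have countable_cover: "\<kappa> (\<Union>i. U i) \<le> (\<Sum>i. \<kappa> (U i))"
    if opn: "\<And>i. open (U i)" for U :: "nat \<Rightarrow> 'a set"
    unfolding \<kappa>_def[of "\<Union>i. U i"]
  proof (rule SUP_least)
    fix K assume "K \<in> \<K> (\<Union>i. U i)"
    then have K: "compact K" "closed K" "K \<subseteq> (\<Union>i\<in>UNIV. U i)" by (auto simp: \<K>_def)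
    obtain I where I: "finite I" "K \<subseteq> (\<Union>i\<in>I. U i)"
      using compactE_image[OF K(1) opn K(3)] by metis
    from I(1) obtain n where "I \<subseteq> {..<n}" using finite_nat_bounded by auto
    with I have "K \<subseteq> (\<Union>i<n. U i)" by blast
    then have "\<nu> K \<le> (\<Sum>i<n. \<kappa> (U i))" by (rule finite_cover[OF K(1,2) opn])
    also have "\<dots> \<le> (\<Sum>i. \<kappa> (U i))" by (rule sum_le_suminf) auto
    finally show "\<nu> K \<le> (\<Sum>i. \<kappa> (U i))" .
  qed
  have outer: "outer_measure_space UNIV \<mu>"
    unfolding outer_measure_space_def
  proof (intro conjI)
    show "positive UNIV \<mu>"
      by (simp add: positive_def \<mu>_open \<kappa>_empty)
    show "increasing UNIV \<mu>"
      by (simp add: increasing_def \<mu>_mono)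
    show "countably_subadditive UNIV \<mu>"
      unfolding countably_subadditive_def
    proof (intro allI impI)
      fix A :: "nat \<Rightarrow> 'a set"
      show "\<mu> (\<Union>i. A i) \<le> (\<Sum>i. \<mu> (A i))"
      proof (rule ennreal_le_epsilon)
        fix e :: real assume "0 < e" "(\<Sum>n. \<mu> (A n)) < top"
        then have *: "\<And>n. \<mu> (A n) < \<mu> (A n) + e * (1/2)^Suc n"
          by (auto simp add: less_top dest!: ennreal_suminf_lessD)
        have "\<exists>U. open U \<and> A n \<subseteq> U \<and> \<kappa> U \<le> \<mu> (A n) + e * (1/2)^Suc n" for n
          using *[of n, THEN order.strict_trans2[OF _ order.refl]]
          unfolding \<mu>_def[of "A n"] INF_less_iff by (auto intro: less_imp_le)
        then obtain U where U: "\<And>n. open (U n)" "\<And>n. A n \<subseteq> U n"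
          "\<And>n. \<kappa> (U n) \<le> \<mu> (A n) + e * (1/2)^Suc n"
          by metis
        have "\<mu> (\<Union>i. A i) \<le> \<kappa> (\<Union>i. U i)"
          using U by (intro \<mu>_upper) auto
        also have "\<dots> \<le> (\<Sum>i. \<kappa> (U i))"
          by (rule countable_cover) fact
        also have "\<dots> \<le> (\<Sum>n. \<mu> (A n) + e * (1/2) ^ Suc n)"
          by (intro suminf_le U) auto
        also have "\<dots> = (\<Sum>n. \<mu> (A n)) + (\<Sum>n. ennreal e * ennreal ((1/2) ^ Suc n))"
          using \<open>0 < e\<close> by (subst suminf_add[symmetric])
            (auto simp del: ennreal_suminf_cmult simp add: ennreal_mult[symmetric])
        also have "\<dots> = (\<Sum>n. \<mu> (A n)) + e"
          unfolding ennreal_suminf_cmult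
          by (subst suminf_ennreal_eq[OF zero_le_power power_half_series]) auto
        finally show "\<mu> (\<Union>i. A i) \<le> (\<Sum>n. \<mu> (A n)) + e" .
      qed
    qed
  qed
  \<comment> \<open>The Caratheodory lemma is applied with the full power set as the ambient
    sigma-algebra, because \<open>\<mu>\<close> is defined on all sets.\<close>
  interpret P: sigma_algebra "UNIV :: 'a set" UNIV
    using sigma_algebra_Pow[of "UNIV :: 'a set"] by simp
  define L where "L = lambda_system UNIV UNIV \<mu>"
  have L: "measure_space UNIV L \<mu>"
    unfolding L_def by (rule P.caratheodory_lemma[OF outer])
  \<comment> \<open>\<open>subadditive\<close> speaks of disjoint sets only; replacing
    \<open>B\<close> by \<open>B - A\<close> removes the overlap.\<close>
  have subadd: "\<mu> (A \<union> B) \<le> \<mu> A + \<mu> B" for A B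
    using P.countably_subadditive_subadditive[of \<mu>] outer
    by (auto simp: outer_measure_space_def subadditive_def)
       (metis Un_Diff_cancel Diff_disjoint \<mu>_mono Diff_subset add_left_mono order_trans)
  \<comment> \<open>First exhaust \<open>V \<inter> U\<close> by \<open>K\<close>, then exhaust
    \<open>V - K\<close>, which is open and contains \<open>V - U\<close>, by \<open>J\<close>. As
    \<open>K\<close> and \<open>J\<close> are disjoint, \<nu> adds up exactly on their union, which
    lies in \<open>V\<close>.\<close>
  have open_split: "\<mu> (V \<inter> U) + \<mu> (V - U) \<le> \<kappa> V" if U: "open U" and V: "open V" for U V
  proof (rule ennreal_le_epsilon)
    fix e :: real assume "e > 0"
    then obtain K where K: "compact K" "closed K" "K \<subseteq> V \<inter> U" "\<kappa> (V \<inter> U) < \<nu> K + ennreal (e/2)"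
      using \<kappa>_approx[of "e/2" "V \<inter> U"] by auto
    obtain J where J: "compact J" "closed J" "J \<subseteq> V - K" "\<kappa> (V - K) < \<nu> J + ennreal (e/2)"
      using \<kappa>_approx[of "e/2" "V - K"] \<open>e > 0\<close> by auto
    have "\<mu> (V \<inter> U) + \<mu> (V - U) \<le> \<kappa> (V \<inter> U) + \<kappa> (V - K)"
      using U V K by (intro add_mono \<mu>_upper) auto
    also have "\<dots> \<le> (\<nu> K + ennreal (e/2)) + (\<nu> J + ennreal (e/2))"
      using K J by (intro add_mono less_imp_le)
    also have "\<dots> = (\<nu> K + \<nu> J) + (ennreal (e/2) + ennreal (e/2))"
      by (simp add: ac_simps)
    also have "ennreal (e/2) + ennreal (e/2) = ennreal e"
      using \<open>e > 0\<close> by (simp flip: ennreal_plus)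
    also have "\<nu> K + \<nu> J = \<nu> (K \<union> J)"
      using K J by (intro additiveD[OF add, symmetric]) auto
    also have "\<nu> (K \<union> J) \<le> \<kappa> V"
      using K J by (intro \<kappa>_upper) auto
    finally show "\<mu> (V \<inter> U) + \<mu> (V - U) \<le> \<kappa> V + ennreal e" by simp
  qed
  \<comment> \<open>The Caratheodory condition for an arbitrary \<open>E\<close> reduces to open
    supersets of \<open>E\<close>, since \<open>\<mu> E\<close> is an infimum over these.\<close>
  have open_L: "U \<in> L" if U: "open U" for U
    unfolding L_def P.lambda_system_eq
  proof (safe intro!: antisym)
    fix E
    show "\<mu> (E \<inter> U) + \<mu> (E - U) \<le> \<mu> E"
      unfolding \<mu>_def[of E]
    proof (rule INF_greatest)
      fix V assume "V \<in> {V. open V \<and> E \<subseteq> V}"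
      then have "\<mu> (E \<inter> U) + \<mu> (E - U) \<le> \<mu> (V \<inter> U) + \<mu> (V - U)"
        by (intro add_mono \<mu>_mono) auto
      also have "\<dots> \<le> \<kappa> V" using \<open>V \<in> _\<close> U by (intro open_split) auto
      finally show "\<mu> (E \<inter> U) + \<mu> (E - U) \<le> \<kappa> V" .
    qed
    show "\<mu> E \<le> \<mu> (E \<inter> U) + \<mu> (E - U)"
      using subadd[of "E \<inter> U" "E - U"] by (simp add: Int_Diff_Un)
  qed auto
  interpret L: sigma_algebra UNIV L
    using L by (simp add: measure_space_def)
  have "sigma_sets UNIV {S. open S} \<subseteq> L"
    by (rule L.sigma_sets_subset) (auto intro: open_L)
  then have borel_L: "sets borel \<subseteq> L"
    by (simp add: borel_def)
  define \<gamma> where "\<gamma> = measure_of UNIV (sets borel) \<mu>"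
  have sets_\<gamma>: "sets \<gamma> = sets borel"
    by (simp add: \<gamma>_def)
  have em: "emeasure \<gamma> A = \<mu> A" if "A \<in> sets borel" for A
    unfolding \<gamma>_def
  proof (rule emeasure_measure_of_sigma[OF _ _ _ that])
    show "sigma_algebra UNIV (sets (borel :: 'a measure))" ..
    show "positive (sets borel) \<mu>"
      using L borel_L by (auto simp: measure_space_def positive_def)
    show "countably_additive (sets borel) \<mu>"
      using L borel_L by (auto simp: measure_space_def countably_additive_def)
  qed
  have space_\<gamma>: "space \<gamma> = UNIV"
    by (simp add: \<gamma>_def)
  have total: "emeasure \<gamma> UNIV = \<nu> UNIV"
  proof (rule antisym)
    show "emeasure \<gamma> UNIV \<le> \<nu> UNIV"
      by (simp add: em \<mu>_open \<kappa>_le)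
    \<comment> \<open>This is where tightness enters: up to \<open>e\<close>, all of the mass of
      \<nu> sits on one closed compact set, and \<open>\<kappa>\<close> sees that mass.\<close>
    show "\<nu> UNIV \<le> emeasure \<gamma> UNIV"
    proof (rule ennreal_le_epsilon)
      fix e :: real assume "e > 0"
      then obtain K where K: "compact K" "closed K" "\<nu> (- K) < ennreal e"
        using tight by blast
      have "\<nu> UNIV \<le> \<nu> K + \<nu> (- K)"
        using sub[of K "- K"] K by (simp add: borel_comp)
      also have "\<dots> \<le> \<kappa> UNIV + ennreal e"
        using K \<kappa>_upper[of K UNIV] by (intro add_mono) auto
      finally show "\<nu> UNIV \<le> emeasure \<gamma> UNIV + ennreal e"
        by (simp add: em \<mu>_open)
    qed
  qed
  interpret fin_\<gamma>: finite_measure \<gamma>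
    using fin total by (intro finite_measureI) (simp add: space_\<gamma>)
  \<comment> \<open>Inner regularity at \<open>B\<close> is obtained by removing from a tight
    compact set \<open>K\<close> an open set \<open>U\<close> that encloses \<open>- B\<close> with
    little excess. Tightness passes from \<nu> to \<gamma> because \<open>- K\<close> is
    open.\<close>
  have "\<exists>K. compact K \<and> K \<in> sets borel \<and> K \<subseteq> B \<and> measure \<gamma> (B - K) < e"
    if B: "B \<in> sets borel" and e: "e > 0" for B e
  proof -
    obtain K where K: "compact K" "closed K" "\<nu> (- K) < ennreal (e/2)"
      using tight[of "e/2"] e by auto
    have "\<mu> (- B) < \<infinity>"
      using \<mu>_upper[of UNIV "- B"] \<kappa>_fin[of UNIV] by (auto intro: le_less_trans)
    then obtain U where U: "open U" "- B \<subseteq> U" "\<kappa> U < \<mu> (- B) + ennreal (e/2)"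
      using INF_approx_ennreal[OF _ \<mu>_def, of "e/2" "- B"] e by (auto simp: less_top)
    have mU: "measure \<gamma> (U - - B) < e/2"
    proof -
      have "emeasure \<gamma> U < emeasure \<gamma> (- B) + ennreal (e/2)"
        using U B by (simp add: em \<mu>_open borel_comp)
      then have "measure \<gamma> U < measure \<gamma> (- B) + e/2"
        using e by (simp add: fin_\<gamma>.emeasure_eq_measure ennreal_less_iff flip: ennreal_plus)
      moreover have "measure \<gamma> (U - - B) = measure \<gamma> U - measure \<gamma> (- B)"
        using U B by (intro fin_\<gamma>.finite_measure_Diff) (auto simp: sets_\<gamma>)
      ultimately show ?thesis by simp
    qed
    have "emeasure \<gamma> (- K) < ennreal (e/2)"
      using K \<kappa>_le[of "- K"] by (simp add: em \<mu>_open open_Compl borel_comp)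
    then have mK: "measure \<gamma> (- K) < e/2"
      using e by (simp add: fin_\<gamma>.emeasure_eq_measure ennreal_less_iff)
    have "measure \<gamma> (B - (K - U)) \<le> measure \<gamma> ((U - - B) \<union> - K)"
      using U K B by (intro fin_\<gamma>.finite_measure_mono) (auto simp: sets_\<gamma>)
    also have "\<dots> \<le> measure \<gamma> (U - - B) + measure \<gamma> (- K)"
      using U K B by (intro measure_Un_le) (auto simp: sets_\<gamma>)
    also have "\<dots> < e" using mU mK by simp
    finally show ?thesis
      using U K by (intro exI[of _ "K - U"]) (auto intro: compact_diff)
  qed
  then have "\<gamma> \<in> radon_measures"
    unfolding radon_measures_def using sets_\<gamma> fin_\<gamma>.finite_measure_axioms by simp
  then show thesis
    using total by (rule that) (simp add: em \<mu>_open \<kappa>_le)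
qed

section \<open>Setwise convergence\<close>

text \<open>Tychonoff's theorem for a product of intervals gives a cluster point of the sequence
  \<open>m\<close>. A product over uncountably many indices need not be sequentially compact, so a
  subfilter replaces a subsequence.\<close>

lemma bounded_family_cluster:
  fixes m :: "nat \<Rightarrow> 'b \<Rightarrow> real"
  assumes "\<And>n b. m n b \<in> {0..C}"
  obtains G r where "G \<noteq> bot" "G \<le> sequentially" "\<And>b. ((\<lambda>n. m n b) \<longlongrightarrow> r b) G"
proof -
  have "compactin (product_topology (\<lambda>_. euclideanreal) (UNIV :: 'b set)) (PiE UNIV (\<lambda>_. {0..C}))"
    by (simp add: compactin_PiE)
  then have "compact (PiE (UNIV :: 'b set) (\<lambda>_. {0..C}))"
    by (simp add: euclidean_product_topology)
  moreover have "eventually (\<lambda>x. x \<in> PiE UNIV (\<lambda>_. {0..C})) (filtermap m sequentially)"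
    using assms by (simp add: eventually_filtermap PiE_iff)
  moreover have "filtermap m sequentially \<noteq> bot"
    by (simp add: filtermap_bot_iff)
  ultimately obtain r where r: "r \<in> PiE UNIV (\<lambda>_. {0..C})" "inf (nhds r) (filtermap m sequentially) \<noteq> bot"
    unfolding compact_filter by metis
  define G where "G = inf (filtercomap m (nhds r)) sequentially"
  \<comment> \<open>If \<open>G\<close> were trivial, the sequence would eventually avoid some
    neighbourhood of \<open>r\<close>, contradicting that \<open>r\<close> is a cluster
    point.\<close>
  have "G \<noteq> bot"
  proof
    assume "G = bot"
    then have "eventually (\<lambda>_. False) (inf (filtercomap m (nhds r)) sequentially)"
      by (simp add: G_def)
    then obtain P Q where PQ: "eventually P (filtercomap m (nhds r))" "eventually Q sequentially"
      "\<And>n. P n \<Longrightarrow> Q n \<Longrightarrow> False"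
      unfolding eventually_inf by blast
    from PQ(1) obtain P' where P': "eventually P' (nhds r)" "\<And>n. P' (m n) \<Longrightarrow> P n"
      unfolding eventually_filtercomap by blast
    have "eventually (\<lambda>y. \<not> P' y) (filtermap m sequentially)"
      unfolding eventually_filtermap using PQ(2) by eventually_elim (use PQ(3) P'(2) in blast)
    with P'(1) have "eventually (\<lambda>_. False) (inf (nhds r) (filtermap m sequentially))"
      unfolding eventually_inf by blast
    with r(2) show False by (simp add: trivial_limit_def)
  qed
  moreover have "G \<le> sequentially"
    by (simp add: G_def)
  moreover have "((\<lambda>n. m n b) \<longlongrightarrow> r b) G" for b
  proof -
    have "(m \<longlongrightarrow> r) G"
      unfolding G_def by (rule filterlim_mono[OF filterlim_filtercomap order.refl]) simp
    then show ?thesis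
      using continuous_on_tendsto_compose[OF continuous_on_product_coordinates[of b]] by simp
  qed
  ultimately show thesis
    by (rule that)
qed

lemma nn_integral_le_of_setwise_le:
  assumes "sets M = sets N" "\<And>B. B \<in> sets N \<Longrightarrow> emeasure M B \<le> emeasure N B"
  shows "nn_integral M f \<le> nn_integral N f"
  using assms by (intro nn_integral_mono_measure) (auto simp: le_measure)

text \<open>Induction over measurable functions. In the monotone limit the error over any
  \<open>M n\<close> is bounded by the same error over the dominating \<open>N\<close>, uniformly in
  \<open>n\<close>; this also makes the argument work along an arbitrary filter
  \<open>G\<close>.\<close>

lemma nn_integral_tendsto_of_setwise:
  fixes M :: "'i \<Rightarrow> 'a measure" and h :: "'a \<Rightarrow> ennreal"
  assumes sets_M: "\<And>n. sets (M n) = sets N" and sets_L: "sets L = sets N"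
    and dom: "\<And>n B. B \<in> sets N \<Longrightarrow> emeasure (M n) B \<le> emeasure N B"
    and lim: "\<And>B. B \<in> sets N \<Longrightarrow> ((\<lambda>n. emeasure (M n) B) \<longlongrightarrow> emeasure L B) G"
    and h: "h \<in> borel_measurable N" "(\<integral>\<^sup>+x. h x \<partial>N) < \<infinity>"
  shows "((\<lambda>n. \<integral>\<^sup>+x. h x \<partial>M n) \<longlongrightarrow> (\<integral>\<^sup>+x. h x \<partial>L)) G"
proof -
  have meas_M: "u \<in> borel_measurable (M n)" if "u \<in> borel_measurable N" for u :: "'a \<Rightarrow> ennreal" and n
    using that measurable_cong_sets[OF sets_M refl] by blast
  have meas_L: "u \<in> borel_measurable L" if "u \<in> borel_measurable N" for u :: "'a \<Rightarrow> ennreal"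
    using that measurable_cong_sets[OF sets_L refl] by blast
  note space = sets_eq_imp_space_eq[OF sets_M] sets_eq_imp_space_eq[OF sets_L]
  have int_M: "(\<integral>\<^sup>+x. u x \<partial>M n) \<le> (\<integral>\<^sup>+x. u x \<partial>N)" for u n
    by (rule nn_integral_le_of_setwise_le[OF sets_M dom])
  show ?thesis
    using h
  proof (induction rule: borel_measurable_induct)
    case (cong f g)
    then have "(\<integral>\<^sup>+x. f x \<partial>N) = (\<integral>\<^sup>+x. g x \<partial>N)" "(\<integral>\<^sup>+x. f x \<partial>L) = (\<integral>\<^sup>+x. g x \<partial>L)"
      "\<And>n. (\<integral>\<^sup>+x. f x \<partial>M n) = (\<integral>\<^sup>+x. g x \<partial>M n)"
      by (auto intro!: nn_integral_cong simp: space)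
    with cong show ?case by simp
  next
    case (set A)
    then show ?case using lim[of A] by (simp add: sets_M sets_L)
  next
    case (mult u c)
    show ?case
    \<comment> \<open>Only for nonzero \<open>c\<close> does integrability of the multiple give
      integrability of \<open>u\<close>, which the induction hypothesis requires.\<close>
    proof (cases "c = 0")
      case False
      then have "(\<integral>\<^sup>+x. u x \<partial>N) < \<infinity>"
        using mult by (auto simp: nn_integral_cmult ennreal_mult_less_top)
      then show ?thesis
        using mult by (simp add: nn_integral_cmult meas_M meas_L ennreal_tendsto_cmult)
    qed simp
  next
    case (add u v)
    then show ?case
      by (auto simp: nn_integral_add meas_M meas_L intro!: tendsto_add)
  next
    case (seq U)
    let ?u = "SUP i. U i"
    have le: "U i x \<le> ?u x" for i x
      by (auto intro: SUP_upper2[of i] simp: image_comp)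
    have fin: "(\<integral>\<^sup>+x. U i x \<partial>N) < \<infinity>" for i
      using nn_integral_mono[of N "U i" ?u] le seq.prems by (meson le_less_trans)
    have SUP: "(\<integral>\<^sup>+x. ?u x \<partial>K) = (SUP i. \<integral>\<^sup>+x. U i x \<partial>K)" if "sets K = sets N" for K
      unfolding SUP_apply
      using seq(1) \<open>incseq U\<close> measurable_cong_sets[OF that refl]
      by (intro nn_integral_monotone_convergence_SUP) blast+
    have meas_u: "?u \<in> borel_measurable N"
    proof -
      have "?u = (\<lambda>x. SUP i. U i x)" by (simp add: fun_eq_iff image_comp)
      then show ?thesis using seq(1) by simp
    qed
    \<comment> \<open>\<open>\<delta> i\<close> is the uniform truncation error. It tends to 0
      because the full integral over \<open>N\<close> is finite.\<close>
    define \<delta> where "\<delta> i = (\<integral>\<^sup>+x. ?u x - U i x \<partial>N)" for i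
    have \<delta>: "\<delta> \<longlonglongrightarrow> 0"
    proof -
      have "(\<lambda>i. \<integral>\<^sup>+x. U i x \<partial>N) \<longlonglongrightarrow> (\<integral>\<^sup>+x. ?u x \<partial>N)"
        unfolding SUP[OF refl] using \<open>incseq U\<close>
        by (intro LIMSEQ_SUP) (auto simp: incseq_def le_fun_def intro!: nn_integral_mono)
      then have "(\<lambda>i. (\<integral>\<^sup>+x. ?u x \<partial>N) - (\<integral>\<^sup>+x. U i x \<partial>N)) \<longlonglongrightarrow> (\<integral>\<^sup>+x. ?u x \<partial>N) - (\<integral>\<^sup>+x. ?u x \<partial>N)"
        using seq.prems by (intro tendsto_diff_ennreal tendsto_const) auto
      moreover have "\<delta> = (\<lambda>i. (\<integral>\<^sup>+x. ?u x \<partial>N) - (\<integral>\<^sup>+x. U i x \<partial>N))"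
        unfolding \<delta>_def by (intro ext nn_integral_diff meas_u seq(1) AE_I2 le) (use fin in \<open>simp add: less_top\<close>)
      ultimately show ?thesis
        using seq.prems by (simp add: ennreal_minus_cancel_iff)
    qed
    have upper: "(\<integral>\<^sup>+x. ?u x \<partial>M n) \<le> (\<integral>\<^sup>+x. U i x \<partial>M n) + \<delta> i" for n i
    proof -
      have "(\<integral>\<^sup>+x. ?u x \<partial>M n) = (\<integral>\<^sup>+x. U i x + (?u x - U i x) \<partial>M n)"
        using le by (simp add: add_diff_inverse_ennreal)
      also have "\<dots> = (\<integral>\<^sup>+x. U i x \<partial>M n) + (\<integral>\<^sup>+x. ?u x - U i x \<partial>M n)"
        using seq(1) meas_u by (intro nn_integral_add meas_M borel_measurable_minus_ennreal)
      also have "\<dots> \<le> (\<integral>\<^sup>+x. U i x \<partial>M n) + \<delta> i"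
        unfolding \<delta>_def by (intro add_left_mono int_M)
      finally show ?thesis .
    qed
    have IH: "((\<lambda>n. \<integral>\<^sup>+x. U i x \<partial>M n) \<longlongrightarrow> (\<integral>\<^sup>+x. U i x \<partial>L)) G" for i
      using seq.IH fin by blast
    \<comment> \<open>The lower bound needs only monotonicity in a single \<open>U i\<close>; the
      upper bound pays \<open>\<delta> i\<close>, with \<open>i\<close> fixed before passing to the
      limit along \<open>G\<close>.\<close>
    show ?case
    proof (rule order_tendstoI)
      fix a assume "a < (\<integral>\<^sup>+x. ?u x \<partial>L)"
      then obtain i where "a < (\<integral>\<^sup>+x. U i x \<partial>L)"
        unfolding SUP[OF sets_L] less_SUP_iff by blast
      from order_tendstoD(1)[OF IH this] show "eventually (\<lambda>n. a < (\<integral>\<^sup>+x. ?u x \<partial>M n)) G"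
        by eventually_elim (meson le less_le_trans nn_integral_mono)
    next
      fix a assume "(\<integral>\<^sup>+x. ?u x \<partial>L) < a"
      moreover have "(\<lambda>i. (\<integral>\<^sup>+x. ?u x \<partial>L) + \<delta> i) \<longlonglongrightarrow> (\<integral>\<^sup>+x. ?u x \<partial>L) + 0"
        by (intro tendsto_add tendsto_const \<delta>)
      ultimately have "eventually (\<lambda>i. (\<integral>\<^sup>+x. ?u x \<partial>L) + \<delta> i < a) sequentially"
        by (intro order_tendstoD(2)) auto
      then obtain i where i: "(\<integral>\<^sup>+x. ?u x \<partial>L) + \<delta> i < a"
        by (auto simp: eventually_sequentially)
      have "(\<integral>\<^sup>+x. U i x \<partial>L) + \<delta> i < a"
        using i nn_integral_mono[of L "U i" ?u] le by (meson add_right_mono le_less_trans)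
      from order_tendstoD(2)[OF tendsto_add[OF IH tendsto_const] this]
      show "eventually (\<lambda>n. (\<integral>\<^sup>+x. ?u x \<partial>M n) < a) G"
        by eventually_elim (use upper le_less_trans in blast)
    qed
  qed
qed

text \<open>Sums of two terms commute with limits, which gives finite additivity only;
  \<open>radon_measure_of_content\<close> then produces a genuine measure.\<close>

lemma content_of_setwise_limit:
  fixes M :: "nat \<Rightarrow> 'a measure"
  assumes sets_M: "\<And>n. sets (M n) = \<A>" and "\<A> = sets N"
    and G: "G \<noteq> bot" and lim: "\<And>A. A \<in> \<A> \<Longrightarrow> ((\<lambda>n. emeasure (M n) A) \<longlongrightarrow> \<nu> A) G"
  shows "positive \<A> \<nu>" "additive \<A> \<nu>"
proof -
  have "((\<lambda>n. emeasure (M n) {}) \<longlongrightarrow> \<nu> {}) G"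
    using assms by (intro lim) auto
  then show "positive \<A> \<nu>"
    using tendsto_unique[OF G _ tendsto_const, of 0] by (simp add: positive_def)
  show "additive \<A> \<nu>"
    unfolding additive_def
  proof (intro ballI impI)
    fix A B assume AB: "A \<in> \<A>" "B \<in> \<A>" "A \<inter> B = {}"
    have "((\<lambda>n. emeasure (M n) (A \<union> B)) \<longlongrightarrow> \<nu> (A \<union> B)) G"
      using AB assms(2) by (intro lim) auto
    moreover have "emeasure (M n) (A \<union> B) = emeasure (M n) A + emeasure (M n) B" for n
      using AB sets_M by (intro plus_emeasure[symmetric]) auto
    moreover have "((\<lambda>n. emeasure (M n) A + emeasure (M n) B) \<longlongrightarrow> \<nu> A + \<nu> B) G"
      using AB by (intro tendsto_add lim)
    ultimately show "\<nu> (A \<union> B) = \<nu> A + \<nu> B"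
      using tendsto_unique[OF G] by simp
  qed
qed

text \<open>Enclosing \<open>Q\<close> in an open \<open>U\<close> with small excess for \<pi> also
  controls the excess for \<nu> between the preimages, so \<gamma> lies below \<nu> on every
  preimage. Applied to a set and its complement, equality of the total masses turns this into
  equality.\<close>

lemma emeasure_vimage_eq_content:
  fixes \<nu> :: "'a::topological_space set \<Rightarrow> ennreal" and \<pi> :: "'b::topological_space measure"
  assumes reg: "regular_space (euclidean :: 'b topology)" and \<pi>: "\<pi> \<in> radon_measures"
    and \<gamma>: "sets \<gamma> = sets borel" "emeasure \<gamma> UNIV = \<nu> UNIV" "\<And>U. open U \<Longrightarrow> emeasure \<gamma> U \<le> \<nu> U"
    and add: "additive (sets borel) \<nu>" and fin: "\<nu> UNIV < \<infinity>"
    and f: "continuous_on UNIV f"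
    and dom: "\<And>Q. Q \<in> sets borel \<Longrightarrow> \<nu> (f -` Q) \<le> emeasure \<pi> Q"
    and P: "P \<in> sets borel"
  shows "emeasure \<gamma> (f -` P) = \<nu> (f -` P)"
proof -
  have vimage: "f -` Q \<in> sets borel" if "Q \<in> sets borel" for Q
    using measurable_sets[OF borel_measurable_continuous_onI[OF f] that] by simp
  have space_\<gamma>: "space \<gamma> = UNIV"
    using sets_eq_imp_space_eq[OF \<gamma>(1)] by simp
  interpret \<pi>: finite_measure \<pi>
    using \<pi> by (simp add: radon_measures_def)
  have sets_\<pi>: "sets \<pi> = sets borel"
    using \<pi> by (simp add: radon_measures_def)
  have le: "emeasure \<gamma> (f -` Q) \<le> \<nu> (f -` Q)" if Q: "Q \<in> sets borel" for Q
  proof (rule ennreal_le_epsilon)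
    fix e :: real assume "e > 0"
    then obtain U where U: "open U" "Q \<subseteq> U" "measure \<pi> (U - Q) < e"
      using radon_measures_outer_regular[OF reg \<pi> Q] by metis
    have "emeasure \<gamma> (f -` Q) \<le> emeasure \<gamma> (f -` U)"
      using U vimage[of U] by (intro emeasure_mono) (auto simp: \<gamma>(1))
    also have "\<dots> \<le> \<nu> (f -` U)"
      using U f by (intro \<gamma>(3) open_vimage)
    also have "f -` U = f -` Q \<union> f -` (U - Q)"
      using U by auto
    also have "\<nu> \<dots> = \<nu> (f -` Q) + \<nu> (f -` (U - Q))"
      using U Q by (intro additiveD[OF add] vimage) auto
    also have "\<dots> \<le> \<nu> (f -` Q) + emeasure \<pi> (U - Q)"
      using U Q by (intro add_left_mono dom) auto
    also have "emeasure \<pi> (U - Q) \<le> ennreal e"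
      using U by (simp add: \<pi>.emeasure_eq_measure ennreal_leI)
    finally show "emeasure \<gamma> (f -` Q) \<le> \<nu> (f -` Q) + ennreal e"
      by (simp add: add_left_mono)
  qed
  have part: "f -` P \<union> f -` (- P) = UNIV" "f -` P \<inter> f -` (- P) = {}"
    by auto
  have "- P \<in> sets borel"
    using P by (simp add: borel_comp)
  note meas = vimage[OF P] vimage[OF this]
  have total: "\<nu> (f -` P) + \<nu> (f -` (- P)) = \<nu> UNIV"
    using additiveD[OF add part(2) meas] part(1) by simp
  also have "\<dots> = emeasure \<gamma> (f -` P) + emeasure \<gamma> (f -` (- P))"
    using plus_emeasure[of "f -` P" \<gamma> "f -` (- P)"] meas part \<gamma>(1,2) by simp
  also have "\<dots> \<le> emeasure \<gamma> (f -` P) + \<nu> (f -` (- P))"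
    by (intro add_left_mono le) fact
  finally have *: "\<nu> (f -` P) + \<nu> (f -` (- P)) \<le> emeasure \<gamma> (f -` P) + \<nu> (f -` (- P))" .
  \<comment> \<open>Finiteness is what permits cancellation in \<open>ennreal\<close>.\<close>
  have "\<nu> (f -` (- P)) \<noteq> \<infinity>"
    using total fin by auto
  with * have "\<nu> (f -` P) \<le> emeasure \<gamma> (f -` P)"
    by (simp add: ennreal_add_left_cancel_le add.commute)
  with le[OF P] show ?thesis by simp
qed

text \<open>The second marginal need not integrate \<open>k\<close>, so convergence only yields an inequality for
  it; applying that to \<open>E\<close> and to its complement forces equality, as the total integrals agree.\<close>

lemma balance_of_setwise_limit:
  fixes \<alpha>s \<beta>s :: "'i \<Rightarrow> 'a measure" and k :: "'a \<Rightarrow> ennreal"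
  assumes G: "G \<noteq> bot"
    and sets_\<alpha>: "\<And>n. sets (\<alpha>s n) = sets N" "sets \<alpha> = sets N" "sets \<pi>1 = sets N"
    and sets_\<beta>: "\<And>n. sets (\<beta>s n) = sets N" "sets \<beta> = sets N" "sets \<pi>2 = sets N"
    and dom_\<alpha>: "\<And>n B. B \<in> sets N \<Longrightarrow> emeasure (\<alpha>s n) B \<le> emeasure \<pi>1 B"
    and dom_\<beta>: "\<And>n B. B \<in> sets N \<Longrightarrow> emeasure (\<beta>s n) B \<le> emeasure \<pi>2 B"
    and lim_\<alpha>: "\<And>B. B \<in> sets N \<Longrightarrow> ((\<lambda>n. emeasure (\<alpha>s n) B) \<longlongrightarrow> emeasure \<alpha> B) G"
    and lim_\<beta>: "\<And>B. B \<in> sets N \<Longrightarrow> ((\<lambda>n. emeasure (\<beta>s n) B) \<longlongrightarrow> emeasure \<beta> B) G"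
    and k: "k \<in> borel_measurable N" "(\<integral>\<^sup>+x. k x \<partial>\<pi>1) < \<infinity>" "\<And>x. k x < \<infinity>"
    and \<pi>2: "finite_measure \<pi>2"
    and total: "(\<integral>\<^sup>+x. k x \<partial>\<alpha>) = (\<integral>\<^sup>+x. k x \<partial>\<beta>)"
    and E: "E \<in> sets N"
    and bal: "\<And>n. (\<integral>\<^sup>+x\<in>E. k x \<partial>\<alpha>s n) = (\<integral>\<^sup>+x\<in>E. k x \<partial>\<beta>s n)"
      "\<And>n. (\<integral>\<^sup>+x\<in>space N - E. k x \<partial>\<alpha>s n) = (\<integral>\<^sup>+x\<in>space N - E. k x \<partial>\<beta>s n)"
  shows "(\<integral>\<^sup>+x\<in>E. k x \<partial>\<alpha>) = (\<integral>\<^sup>+x\<in>E. k x \<partial>\<beta>)"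
proof -
  have le: "(\<integral>\<^sup>+x\<in>F. k x \<partial>\<beta>) \<le> (\<integral>\<^sup>+x\<in>F. k x \<partial>\<alpha>)"
    if F: "F \<in> sets N" and bal_F: "\<And>n. (\<integral>\<^sup>+x\<in>F. k x \<partial>\<alpha>s n) = (\<integral>\<^sup>+x\<in>F. k x \<partial>\<beta>s n)" for F
  proof -
    \<comment> \<open>The truncation at height \<open>i\<close> is integrable for the finite measure
      \<open>\<pi>2\<close>, so its integrals converge. Along the way they stay below the balanced
      integrals over \<open>\<alpha>s n\<close>, whose limit is controlled by \<open>\<pi>1\<close>;
      monotone convergence in \<open>i\<close> then removes the truncation.\<close>
    let ?g = "\<lambda>i::nat. \<lambda>x. min (k x) (of_nat i) * indicator F x"
    have meas: "?g i \<in> borel_measurable N" "(\<lambda>x. k x * indicator F x) \<in> borel_measurable N" for i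
      using k(1) F by measurable
    have "(\<integral>\<^sup>+x. k x * indicator F x \<partial>\<pi>1) \<le> (\<integral>\<^sup>+x. k x \<partial>\<pi>1)"
      by (intro nn_integral_mono) (auto split: split_indicator)
    then have lim_F: "((\<lambda>n. \<integral>\<^sup>+x\<in>F. k x \<partial>\<alpha>s n) \<longlongrightarrow> (\<integral>\<^sup>+x\<in>F. k x \<partial>\<alpha>)) G"
      using meas k(2) measurable_cong_sets[OF sets_\<alpha>(3) refl]
      by (intro nn_integral_tendsto_of_setwise[where N = \<pi>1]) (auto simp: sets_\<alpha> dom_\<alpha> lim_\<alpha>)
    have trunc: "(\<integral>\<^sup>+x. ?g i x \<partial>\<beta>) \<le> (\<integral>\<^sup>+x\<in>F. k x \<partial>\<alpha>)" for i
    proof (rule tendsto_le[OF G lim_F])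
      have "(\<integral>\<^sup>+x. ?g i x \<partial>\<pi>2) \<le> (\<integral>\<^sup>+x. of_nat i \<partial>\<pi>2)"
        by (intro nn_integral_mono) (auto split: split_indicator)
      also have "\<dots> < \<infinity>"
        using finite_measure.emeasure_finite[OF \<pi>2, of "space \<pi>2"]
        by (simp add: ennreal_mult_less_top less_top of_nat_less_top)
      finally show "((\<lambda>n. \<integral>\<^sup>+x. ?g i x \<partial>\<beta>s n) \<longlongrightarrow> (\<integral>\<^sup>+x. ?g i x \<partial>\<beta>)) G"
        using meas measurable_cong_sets[OF sets_\<beta>(3) refl]
        by (intro nn_integral_tendsto_of_setwise[where N = \<pi>2]) (auto simp: sets_\<beta> dom_\<beta> lim_\<beta>)
      show "eventually (\<lambda>n. (\<integral>\<^sup>+x. ?g i x \<partial>\<beta>s n) \<le> (\<integral>\<^sup>+x\<in>F. k x \<partial>\<alpha>s n)) G"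
        unfolding bal_F by (intro always_eventually allI nn_integral_mono mult_right_mono) auto
    qed
    have "(SUP i. ?g i x) = k x * indicator F x" for x
    proof -
      obtain m :: nat where m: "k x \<le> of_nat m"
        using k(3)[of x] ennreal_Ex_less_of_nat[of "k x"] by (auto intro: less_imp_le)
      show ?thesis
      proof (rule antisym)
        show "(SUP i. ?g i x) \<le> k x * indicator F x"
          by (intro SUP_least mult_right_mono) auto
        show "k x * indicator F x \<le> (SUP i. ?g i x)"
          by (rule SUP_upper2[of m]) (use m in \<open>auto simp: min_def\<close>)
      qed
    qed
    then have "(\<integral>\<^sup>+x\<in>F. k x \<partial>\<beta>) = (\<integral>\<^sup>+x. (SUP i. ?g i x) \<partial>\<beta>)"
      by simp
    also have "\<dots> = (SUP i. \<integral>\<^sup>+x. ?g i x \<partial>\<beta>)"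
    proof (rule nn_integral_monotone_convergence_SUP)
      show "incseq ?g"
        unfolding incseq_def le_fun_def
        by (intro allI impI mult_right_mono min.mono order.refl of_nat_mono) auto
      show "?g i \<in> borel_measurable \<beta>" for i
        using meas measurable_cong_sets[OF sets_\<beta>(2) refl] by blast
    qed
    also have "\<dots> \<le> (\<integral>\<^sup>+x\<in>F. k x \<partial>\<alpha>)"
      by (intro SUP_least trunc)
    finally show ?thesis .
  qed
  have split: "(\<integral>\<^sup>+x. k x \<partial>M) = (\<integral>\<^sup>+x\<in>E. k x \<partial>M) + (\<integral>\<^sup>+x\<in>space N - E. k x \<partial>M)"
    if "sets M = sets N" for M
  proof -
    have "(\<integral>\<^sup>+x\<in>E. k x \<partial>M) + (\<integral>\<^sup>+x\<in>space N - E. k x \<partial>M)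
        = (\<integral>\<^sup>+x. k x * indicator E x + k x * indicator (space N - E) x \<partial>M)"
      using k(1) E that measurable_cong_sets[OF that refl]
      by (intro nn_integral_add[symmetric] borel_measurable_times_ennreal borel_measurable_indicator) auto
    also have "\<dots> = (\<integral>\<^sup>+x. k x \<partial>M)"
      using sets_eq_imp_space_eq[OF that]
      by (intro nn_integral_cong) (auto split: split_indicator)
    finally show ?thesis ..
  qed
  have le_E: "(\<integral>\<^sup>+x\<in>E. k x \<partial>\<beta>) \<le> (\<integral>\<^sup>+x\<in>E. k x \<partial>\<alpha>)"
    by (rule le[OF E bal(1)])
  have le_C: "(\<integral>\<^sup>+x\<in>space N - E. k x \<partial>\<beta>) \<le> (\<integral>\<^sup>+x\<in>space N - E. k x \<partial>\<alpha>)"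
    using E by (intro le bal(2)) auto
  have dom: "emeasure \<alpha> B \<le> emeasure \<pi>1 B" if "B \<in> sets N" for B
    using tendsto_upperbound[OF lim_\<alpha>[OF that] _ G] dom_\<alpha>[OF that] by simp
  have "(\<integral>\<^sup>+x. k x \<partial>\<alpha>) \<le> (\<integral>\<^sup>+x. k x \<partial>\<pi>1)"
    by (rule nn_integral_le_of_setwise_le) (auto simp: sets_\<alpha> dom)
  then have fin_\<alpha>: "(\<integral>\<^sup>+x. k x \<partial>\<alpha>) < \<infinity>"
    using k(2) by (rule le_less_trans)
  \<comment> \<open>Finiteness on the \<beta> side comes from equality of the total integrals and
    the bound by \<open>\<pi>1\<close>; it allows the complementary part to be cancelled.\<close>
  have "(\<integral>\<^sup>+x\<in>space N - E. k x \<partial>\<beta>) \<le> (\<integral>\<^sup>+x\<in>E. k x \<partial>\<beta>) + (\<integral>\<^sup>+x\<in>space N - E. k x \<partial>\<beta>)"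
    by simp
  also have "\<dots> = (\<integral>\<^sup>+x. k x \<partial>\<alpha>)"
    unfolding total by (rule split[OF sets_\<beta>(2), symmetric])
  also note fin_\<alpha>
  finally have fin: "(\<integral>\<^sup>+x\<in>space N - E. k x \<partial>\<beta>) \<noteq> \<infinity>"
    by (rule less_imp_neq)
  have cancel: "a \<le> b" if "a + d \<le> b + d" "d \<noteq> \<infinity>" for a b d :: ennreal
    using that ennreal_add_left_cancel_le[of d a b] by (simp add: add.commute)
  have "(\<integral>\<^sup>+x\<in>E. k x \<partial>\<alpha>) + (\<integral>\<^sup>+x\<in>space N - E. k x \<partial>\<beta>) \<le> (\<integral>\<^sup>+x. k x \<partial>\<alpha>)"
    unfolding split[OF sets_\<alpha>(2)] by (intro add_left_mono le_C)
  also have "\<dots> = (\<integral>\<^sup>+x\<in>E. k x \<partial>\<beta>) + (\<integral>\<^sup>+x\<in>space N - E. k x \<partial>\<beta>)"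
    unfolding total by (rule split[OF sets_\<beta>(2)])
  finally have "(\<integral>\<^sup>+x\<in>E. k x \<partial>\<alpha>) \<le> (\<integral>\<^sup>+x\<in>E. k x \<partial>\<beta>)"
    using fin by (rule cancel)
  with le_E show ?thesis by (rule antisym[rotated])
qed

section \<open>Exchange plans\<close>

lemma exchange_coordinates:
  shows "continuous_on UNIV (\<lambda>(x, y, s). (x, s) :: 'x::topological_space \<times> 's::topological_space)"
    and "continuous_on UNIV (\<lambda>(x :: 'x, y, s). (y, s) :: 'x::topological_space \<times> 's::topological_space)"
  by (auto simp: case_prod_unfold intro!: continuous_intros)

lemma emeasure_proj:
  fixes \<gamma> :: "('x::topological_space \<times> 'x \<times> 's::topological_space) measure"
  assumes "sets \<gamma> = sets borel" "B \<in> sets borel"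
  shows "emeasure (proj_XS \<gamma>) B = emeasure \<gamma> ((\<lambda>(x, y, s). (x, s)) -` B)"
    and "emeasure (proj_YS \<gamma>) B = emeasure \<gamma> ((\<lambda>(x, y, s). (y, s)) -` B)"
proof -
  have meas: "g \<in> measurable \<gamma> borel" if "continuous_on UNIV g" for g :: "_ \<Rightarrow> 'x \<times> 's"
    using borel_measurable_continuous_onI[OF that] measurable_cong_sets[OF assms(1) refl] by blast
  have "space \<gamma> = UNIV"
    using sets_eq_imp_space_eq[OF assms(1)] by simp
  then show "emeasure (proj_XS \<gamma>) B = emeasure \<gamma> ((\<lambda>(x, y, s). (x, s)) -` B)"
    "emeasure (proj_YS \<gamma>) B = emeasure \<gamma> ((\<lambda>(x, y, s). (y, s)) -` B)"
    unfolding proj_XS_def proj_YS_def emeasure_distr[OF meas[OF exchange_coordinates(1)] assms(2)]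
      emeasure_distr[OF meas[OF exchange_coordinates(2)] assms(2)]
    by simp_all
qed

text \<open>For \<open>k\<close> depending on the second coordinate only, the right-hand sides
  become the two sides of the balance condition, which is thus a statement about the
  marginals.\<close>

lemma nn_integral_proj:
  fixes \<gamma> :: "('x::topological_space \<times> 'x \<times> 's::topological_space) measure"
  assumes "sets \<gamma> = sets borel" "k \<in> borel_measurable borel" "A \<in> sets borel"
  shows "(\<integral>\<^sup>+z\<in>A \<times> UNIV. k z \<partial>proj_XS \<gamma>) = (\<integral>\<^sup>+\<omega>\<in>A \<times> UNIV \<times> UNIV. k (fst \<omega>, snd (snd \<omega>)) \<partial>\<gamma>)"
    and "(\<integral>\<^sup>+z\<in>A \<times> UNIV. k z \<partial>proj_YS \<gamma>) = (\<integral>\<^sup>+\<omega>\<in>UNIV \<times> A \<times> UNIV. k (fst (snd \<omega>), snd (snd \<omega>)) \<partial>\<gamma>)"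
proof -
  have meas: "g \<in> measurable \<gamma> borel" if "continuous_on UNIV g" for g :: "_ \<Rightarrow> 'x \<times> 's"
    using borel_measurable_continuous_onI[OF that] measurable_cong_sets[OF assms(1) refl] by blast
  \<comment> \<open>Seen as the preimage of \<open>A\<close> under the continuous map
    \<open>fst\<close>; the Borel sets of the product may form more than the product
    sigma-algebra.\<close>
  have "A \<times> UNIV \<in> sets (borel :: ('x \<times> 's) measure)"
    using measurable_sets[OF borel_measurable_continuous_onI assms(3), of fst]
    by (simp add: fst_vimage_eq_Times continuous_on_fst continuous_on_id)
  then have k: "(\<lambda>z. k z * indicator (A \<times> UNIV) z) \<in> borel_measurable (distr \<gamma> borel T)" for T
    using assms(2) by simp
  show "(\<integral>\<^sup>+z\<in>A \<times> UNIV. k z \<partial>proj_XS \<gamma>) = (\<integral>\<^sup>+\<omega>\<in>A \<times> UNIV \<times> UNIV. k (fst \<omega>, snd (snd \<omega>)) \<partial>\<gamma>)"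
    unfolding proj_XS_def nn_integral_distr[OF meas[OF exchange_coordinates(1)] k]
    by (intro nn_integral_cong) (auto split: split_indicator)
  show "(\<integral>\<^sup>+z\<in>A \<times> UNIV. k z \<partial>proj_YS \<gamma>) = (\<integral>\<^sup>+\<omega>\<in>UNIV \<times> A \<times> UNIV. k (fst (snd \<omega>), snd (snd \<omega>)) \<partial>\<gamma>)"
    unfolding proj_YS_def nn_integral_distr[OF meas[OF exchange_coordinates(2)] k]
    by (intro nn_integral_cong) (auto split: split_indicator)
qed

lemma regular_space_euclidean_prod:
  assumes "regular_space (euclidean :: 'a::topological_space topology)"
    and "regular_space (euclidean :: 'b::topological_space topology)"
  shows "regular_space (euclidean :: ('a \<times> 'b) topology)"
  using assms regular_space_prod_topology[of "euclidean :: 'a topology" "euclidean :: 'b topology"]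
  by simp

text \<open>The compactness step: one filter and one Radon measure serve both marginals. Convergence
  is asserted for the marginals alone, since on other Borel sets the measure may differ from the
  setwise limit.\<close>

lemma dominated_marginals_cluster:
  fixes \<pi>p \<pi>m :: "('x::topological_space \<times> 's::topological_space) measure"
    and \<gamma>s :: "nat \<Rightarrow> ('x \<times> 'x \<times> 's) measure"
  assumes reg: "regular_space (euclidean :: 'x topology)" "regular_space (euclidean :: 's topology)"
    and \<pi>p: "\<pi>p \<in> radon_measures" and \<pi>m: "\<pi>m \<in> radon_measures"
    and \<gamma>s: "\<And>n. \<gamma>s n \<in> radon_measures"
    and dom_p: "\<And>n B. B \<in> sets borel \<Longrightarrow> emeasure (proj_XS (\<gamma>s n)) B \<le> emeasure \<pi>p B"
    and dom_m: "\<And>n B. B \<in> sets borel \<Longrightarrow> emeasure (proj_YS (\<gamma>s n)) B \<le> emeasure \<pi>m B"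
  obtains G \<gamma> where "G \<noteq> bot" "G \<le> sequentially" "\<gamma> \<in> radon_measures"
    "\<forall>B\<in>sets borel. ((\<lambda>n. emeasure (proj_XS (\<gamma>s n)) B) \<longlongrightarrow> emeasure (proj_XS \<gamma>) B) G"
    "\<forall>B\<in>sets borel. ((\<lambda>n. emeasure (proj_YS (\<gamma>s n)) B) \<longlongrightarrow> emeasure (proj_YS \<gamma>) B) G"
proof -
  note reg_XS = regular_space_euclidean_prod[OF reg]
  note reg_XYS = regular_space_euclidean_prod[OF reg(1) reg_XS]
  have sets_\<gamma>: "sets (\<gamma>s n) = sets borel" and fin_\<gamma>: "finite_measure (\<gamma>s n)" for n
    using \<gamma>s[of n] by (auto simp: radon_measures_def)
  interpret \<pi>p: finite_measure \<pi>p using \<pi>p by (simp add: radon_measures_def)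
  interpret \<pi>m: finite_measure \<pi>m using \<pi>m by (simp add: radon_measures_def)
  let ?f = "\<lambda>(x :: 'x, y :: 'x, s :: 's). (x, s)" and ?g = "\<lambda>(x :: 'x, y :: 'x, s :: 's). (y, s)"
  note f = exchange_coordinates(1)[where ?'x = 'x and ?'s = 's and ?'a = 'x]
  note g = exchange_coordinates(2)[where ?'x = 'x and ?'s = 's]
  have vimage: "h -` B \<in> sets borel" if "continuous_on UNIV h" "B \<in> sets borel"
    for h :: "'x \<times> 'x \<times> 's \<Rightarrow> 'x \<times> 's" and B
    using measurable_sets[OF borel_measurable_continuous_onI[OF that(1)] that(2)] by simp
  have dom_f: "emeasure (\<gamma>s n) (?f -` B) \<le> emeasure \<pi>p B"
    and dom_g: "emeasure (\<gamma>s n) (?g -` B) \<le> emeasure \<pi>m B" if "B \<in> sets borel" for n B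
    using dom_p[OF that, of n] dom_m[OF that, of n] by (simp_all add: emeasure_proj sets_\<gamma> that)
  \<comment> \<open>The bound holds for every set \<open>A\<close>, because nonmeasurable sets have
    measure 0 by convention; hence the cluster argument can be indexed by all sets.\<close>
  have "measure (\<gamma>s n) A \<in> {0..measure \<pi>p UNIV}" for n A
  proof -
    have "measure (\<gamma>s n) A \<le> measure (\<gamma>s n) UNIV"
      using finite_measure.bounded_measure[OF fin_\<gamma>, of n A] sets_eq_imp_space_eq[OF sets_\<gamma>, of n] by simp
    moreover have "measure (\<gamma>s n) UNIV \<le> measure \<pi>p UNIV"
      using dom_f[of UNIV n]
      by (simp add: finite_measure.emeasure_eq_measure[OF fin_\<gamma>] \<pi>p.emeasure_eq_measure)
    ultimately show ?thesis by simp
  qed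
  then obtain G r where G: "G \<noteq> bot" "G \<le> sequentially"
    and r: "\<And>A. ((\<lambda>n. measure (\<gamma>s n) A) \<longlongrightarrow> r A) G"
    using bounded_family_cluster[of "\<lambda>n. measure (\<gamma>s n)"] by metis
  define \<nu> where "\<nu> A = ennreal (r A)" for A
  have lim: "((\<lambda>n. emeasure (\<gamma>s n) A) \<longlongrightarrow> \<nu> A) G" for A
    using r by (simp add: \<nu>_def finite_measure.emeasure_eq_measure[OF fin_\<gamma>] tendsto_ennrealI)
  have pos: "positive (sets borel) \<nu>" and add: "additive (sets borel) \<nu>"
    using content_of_setwise_limit[OF sets_\<gamma> refl G(1) lim] by auto
  have fin: "\<nu> UNIV < \<infinity>"
    by (simp add: \<nu>_def)
  have \<nu>_f: "\<nu> (?f -` B) \<le> emeasure \<pi>p B" and \<nu>_g: "\<nu> (?g -` B) \<le> emeasure \<pi>m B"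
    if "B \<in> sets borel" for B
    using tendsto_upperbound[OF lim _ G(1)] dom_f[OF that] dom_g[OF that] by simp_all
  have tight: "\<exists>K. compact K \<and> closed K \<and> \<nu> (- K) < ennreal e" if e: "e > 0" for e
  proof -
    have "e/2 > 0" using e by simp
    obtain K1 where K1: "compact K1" "closed K1" "measure \<pi>p (- K1) < e/2"
      using radon_measures_tight[OF reg_XS \<pi>p \<open>e/2 > 0\<close>] by metis
    obtain K2 where K2: "compact K2" "closed K2" "measure \<pi>m (- K2) < e/2"
      using radon_measures_tight[OF reg_XS \<pi>m \<open>e/2 > 0\<close>] by metis
    \<comment> \<open>The two preimages need not be compact separately. Their intersection is closed
      and lies in the compact box spanned by the coordinate images of \<open>K1\<close> and
      \<open>K2\<close>.\<close>
    let ?K = "?f -` K1 \<inter> ?g -` K2"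
    have closed: "closed ?K"
      by (intro closed_Int closed_vimage K1 K2 f g)
    have "compact (fst ` K1 \<times> fst ` K2 \<times> snd ` K1)"
      by (intro compact_Times compact_continuous_image continuous_on_fst continuous_on_snd
          continuous_on_id K1 K2)
    then have "compact ((fst ` K1 \<times> fst ` K2 \<times> snd ` K1) \<inter> ?K)"
      using closed by (rule compact_Int_closed)
    moreover have "(fst ` K1 \<times> fst ` K2 \<times> snd ` K1) \<inter> ?K = ?K"
      by force
    ultimately have compact: "compact ?K" by simp
    have meas: "?f -` (- K1) \<in> sets borel" "?g -` (- K2) \<in> sets borel"
      by (rule vimage[OF f borel_comp[OF borel_closed[OF K1(2)]]],
          rule vimage[OF g borel_comp[OF borel_closed[OF K2(2)]]])
    \<comment> \<open>The bound does not depend on \<open>n\<close>, so it survives the passage to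
      \<nu>.\<close>
    have "emeasure (\<gamma>s n) (- ?K) \<le> emeasure \<pi>p (- K1) + emeasure \<pi>m (- K2)" for n
    proof -
      have "- ?K = ?f -` (- K1) \<union> ?g -` (- K2)" by auto
      then have "emeasure (\<gamma>s n) (- ?K) \<le> emeasure (\<gamma>s n) (?f -` (- K1)) + emeasure (\<gamma>s n) (?g -` (- K2))"
        using emeasure_subadditive[of "?f -` (- K1)" "\<gamma>s n" "?g -` (- K2)"] meas by (simp add: sets_\<gamma>)
      also have "\<dots> \<le> emeasure \<pi>p (- K1) + emeasure \<pi>m (- K2)"
        using K1 K2 by (intro add_mono dom_f dom_g) (auto intro: borel_comp)
      finally show ?thesis .
    qed
    then have "\<nu> (- ?K) \<le> emeasure \<pi>p (- K1) + emeasure \<pi>m (- K2)"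
      by (intro tendsto_upperbound[OF lim _ G(1)] always_eventually allI)
    also have "\<dots> = ennreal (measure \<pi>p (- K1) + measure \<pi>m (- K2))"
      by (simp add: \<pi>p.emeasure_eq_measure \<pi>m.emeasure_eq_measure)
    also have "\<dots> < ennreal e"
      using K1 K2 e by (intro ennreal_lessI) auto
    finally show ?thesis using closed compact by blast
  qed
  obtain \<gamma> where \<gamma>: "\<gamma> \<in> radon_measures" "emeasure \<gamma> UNIV = \<nu> UNIV"
    "\<And>U. open U \<Longrightarrow> emeasure \<gamma> U \<le> \<nu> U"
    using radon_measure_of_content[OF reg_XYS pos add fin tight] by metis
  have sets: "sets \<gamma> = sets borel"
    using \<gamma>(1) by (simp add: radon_measures_def)
  have "emeasure \<gamma> (?f -` B) = \<nu> (?f -` B)" "emeasure \<gamma> (?g -` B) = \<nu> (?g -` B)"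
    if "B \<in> sets borel" for B
    using emeasure_vimage_eq_content[OF reg_XS \<pi>p sets \<gamma>(2,3) add fin f \<nu>_f that]
      emeasure_vimage_eq_content[OF reg_XS \<pi>m sets \<gamma>(2,3) add fin g \<nu>_g that] by blast+
  then show thesis
    using G \<gamma>(1) lim by (intro that[of G \<gamma>]) (simp_all add: emeasure_proj sets sets_\<gamma>)
qed

theorem theorem2p1:
  fixes \<pi>p \<pi>m :: "('x::topological_space \<times> 's::topological_space) measure"
    and c :: "'s \<Rightarrow> real"
  assumes "completely_regular_space (euclidean :: 'x topology)"
    and "completely_regular_space (euclidean :: 's topology)"
    and "\<pi>p \<in> radon_measures"
    and "\<pi>m \<in> radon_measures"
    and "c \<in> borel_measurable borel"
    and "\<And>s. 0 < c s"
    and "integrable \<pi>p (\<lambda>(x, s). c s) \<or> integrable \<pi>m (\<lambda>(y, s). c s)"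
  shows "\<exists>\<gamma>opt \<in> exchange_plans \<pi>p \<pi>m c.
           \<forall>\<gamma> \<in> exchange_plans \<pi>p \<pi>m c. exchange_value c \<gamma>opt \<ge> exchange_value c \<gamma>"
proof -
  let ?V = "exchange_value c ` exchange_plans \<pi>p \<pi>m c"
  define k where "k z = ennreal (c (snd z))" for z :: "'x \<times> 's"
  have "snd \<in> borel_measurable (borel :: ('x \<times> 's) measure)"
    by (intro borel_measurable_continuous_onI continuous_on_snd continuous_on_id)
  then have k: "k \<in> borel_measurable borel"
    unfolding k_def using assms(5) by measurable
  \<comment> \<open>The zero plan is feasible, so the supremum of the values is approached by a
    sequence of plans.\<close>
  have "null_measure borel \<in> exchange_plans \<pi>p \<pi>m c"
  proof -
    have "finite_measure (null_measure borel :: ('x \<times> 'x \<times> 's) measure)"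
      by (intro finite_measureI) simp
    moreover have "measure (null_measure borel :: ('x \<times> 'x \<times> 's) measure) B = 0" for B
      by (simp add: measure_def)
    ultimately have "null_measure borel \<in> (radon_measures :: ('x \<times> 'x \<times> 's) measure set)"
      by (auto simp: radon_measures_def intro!: exI[of _ "{}"])
    then show ?thesis
      by (simp add: exchange_plans_def emeasure_proj)
  qed
  then have "?V \<noteq> {}" by blast
  then obtain v where v: "incseq v" "range v \<subseteq> ?V" "Sup ?V = (SUP n. v n)"
    using ennreal_Sup_countable_SUP by metis
  have "\<forall>n. \<exists>\<gamma>\<in>exchange_plans \<pi>p \<pi>m c. v n = exchange_value c \<gamma>"
    using v(2) by blast
  then obtain \<gamma>s where \<gamma>s: "\<And>n. \<gamma>s n \<in> exchange_plans \<pi>p \<pi>m c" "\<And>n. v n = exchange_value c (\<gamma>s n)"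
    by metis
  have radon: "\<gamma>s n \<in> radon_measures" for n
    using \<gamma>s(1) by (simp add: exchange_plans_def)
  then have sets_\<gamma>s: "sets (\<gamma>s n) = sets borel" for n
    by (simp add: radon_measures_def)
  have dom_p: "emeasure (proj_XS (\<gamma>s n)) B \<le> emeasure \<pi>p B"
    and dom_m: "emeasure (proj_YS (\<gamma>s n)) B \<le> emeasure \<pi>m B" if "B \<in> sets borel" for n B
    using \<gamma>s(1)[of n] that by (simp_all add: exchange_plans_def)
  obtain G \<gamma> where G: "G \<noteq> bot" "G \<le> sequentially" and \<gamma>: "\<gamma> \<in> radon_measures"
    and lim: "\<forall>B\<in>sets borel. ((\<lambda>n. emeasure (proj_XS (\<gamma>s n)) B) \<longlongrightarrow> emeasure (proj_XS \<gamma>) B) G"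
      "\<forall>B\<in>sets borel. ((\<lambda>n. emeasure (proj_YS (\<gamma>s n)) B) \<longlongrightarrow> emeasure (proj_YS \<gamma>) B) G"
    by (rule dominated_marginals_cluster[where \<gamma>s = \<gamma>s,
          OF completely_regular_imp_regular_space[OF assms(1)]
            completely_regular_imp_regular_space[OF assms(2)] assms(3,4) radon dom_p dom_m])
  note lim_p = bspec[OF lim(1)] and lim_m = bspec[OF lim(2)]
  have sets_\<gamma>: "sets \<gamma> = sets borel"
    using \<gamma> by (simp add: radon_measures_def)
  have fin: "finite_measure \<pi>p" "finite_measure \<pi>m"
    and sets_\<pi>: "sets \<pi>p = sets borel" "sets \<pi>m = sets borel"
    using assms(3,4) by (simp_all add: radon_measures_def)
  have sets_proj: "sets (proj_XS \<mu>) = sets borel" "sets (proj_YS \<mu>) = sets borel"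
    for \<mu> :: "('x \<times> 'x \<times> 's) measure"
    by (simp_all add: proj_XS_def proj_YS_def)
  have value_proj: "(\<integral>\<^sup>+z. k z \<partial>proj_XS \<mu>) = exchange_value c \<mu>" "(\<integral>\<^sup>+z. k z \<partial>proj_YS \<mu>) = exchange_value c \<mu>"
    if "sets \<mu> = sets borel" for \<mu>
    using nn_integral_proj[OF that k, of UNIV] by (simp_all add: exchange_value_def k_def)
  have bal_n: "(\<integral>\<^sup>+z\<in>A \<times> UNIV. k z \<partial>proj_XS (\<gamma>s n)) = (\<integral>\<^sup>+z\<in>A \<times> UNIV. k z \<partial>proj_YS (\<gamma>s n))"
    if "A \<in> sets borel" for A n
    using nn_integral_proj[OF sets_\<gamma>s k that] \<gamma>s(1)[of n] that by (simp add: exchange_plans_def k_def)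
  \<comment> \<open>The complement of a cylinder is the cylinder over \<open>- A\<close>, so balance
    also holds on complements.\<close>
  have "space borel - A \<times> UNIV = (- A) \<times> (UNIV :: 's set)" for A :: "'x set"
    by auto
  then have bal_n': "(\<integral>\<^sup>+z\<in>space borel - A \<times> UNIV. k z \<partial>proj_XS (\<gamma>s n)) = (\<integral>\<^sup>+z\<in>space borel - A \<times> UNIV. k z \<partial>proj_YS (\<gamma>s n))"
    if "A \<in> sets borel" for A n
    using bal_n[of "- A"] that by (simp add: borel_comp)
  have cyl: "A \<times> UNIV \<in> sets (borel :: ('x \<times> 's) measure)" if "A \<in> sets borel" for A :: "'x set"
    using measurable_sets[OF borel_measurable_continuous_onI that, of fst]
    by (simp add: fst_vimage_eq_Times continuous_on_fst continuous_on_id)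
  have k_fin: "k z < \<infinity>" for z
    by (simp add: k_def)
  \<comment> \<open>Both sides are the value of the same \<gamma>, because the cost depends only on
    the shared coordinate in \<open>'s\<close>.\<close>
  have value_eq: "(\<integral>\<^sup>+z. k z \<partial>proj_XS \<gamma>) = (\<integral>\<^sup>+z. k z \<partial>proj_YS \<gamma>)"
    by (simp add: value_proj sets_\<gamma>)
  have int_k: "(\<integral>\<^sup>+z. k z \<partial>\<pi>) < \<infinity>" if "integrable \<pi> (\<lambda>(x, s). c s)" for \<pi>
  proof -
    have "(\<integral>\<^sup>+z. k z \<partial>\<pi>) = (\<integral>\<^sup>+z. ennreal (norm (case z of (x, s) \<Rightarrow> c s)) \<partial>\<pi>)"
      using assms(6) by (intro nn_integral_cong) (auto simp: k_def less_imp_le)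
    then show ?thesis
      using that by (simp add: integrable_iff_bounded)
  qed
  \<comment> \<open>Integrability against \<open>\<pi>p\<close> or \<open>\<pi>m\<close> selects the
    marginal through which the values converge; the other marginal is handled by
    \<open>balance_of_setwise_limit\<close>. The two cases differ by exchanging these roles.\<close>
  have "((\<lambda>n. exchange_value c (\<gamma>s n)) \<longlongrightarrow> exchange_value c \<gamma>) G \<and>
    (\<forall>A\<in>sets borel. (\<integral>\<^sup>+z\<in>A \<times> UNIV. k z \<partial>proj_XS \<gamma>) = (\<integral>\<^sup>+z\<in>A \<times> UNIV. k z \<partial>proj_YS \<gamma>))"
    using assms(7)
  proof
    assume "integrable \<pi>p (\<lambda>(x, s). c s)"
    note int = int_k[OF this]
    have "((\<lambda>n. \<integral>\<^sup>+z. k z \<partial>proj_XS (\<gamma>s n)) \<longlongrightarrow> (\<integral>\<^sup>+z. k z \<partial>proj_XS \<gamma>)) G"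
      using k measurable_cong_sets[OF sets_\<pi>(1) refl]
      by (intro nn_integral_tendsto_of_setwise[where N = \<pi>p] int)
         (auto simp: sets_proj sets_\<pi> dom_p lim_p)
    moreover have "(\<integral>\<^sup>+z\<in>A \<times> UNIV. k z \<partial>proj_XS \<gamma>) = (\<integral>\<^sup>+z\<in>A \<times> UNIV. k z \<partial>proj_YS \<gamma>)"
      if "A \<in> sets borel" for A
      by (rule balance_of_setwise_limit[OF G(1), where N = borel, OF sets_proj(1) sets_proj(1) sets_\<pi>(1)
          sets_proj(2) sets_proj(2) sets_\<pi>(2) dom_p dom_m lim_p lim_m k int k_fin fin(2) value_eq
          cyl[OF that] bal_n[OF that] bal_n'[OF that]])
    ultimately show ?thesis
      by (simp add: value_proj sets_\<gamma> sets_\<gamma>s)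
  next
    assume "integrable \<pi>m (\<lambda>(x, s). c s)"
    note int = int_k[OF this]
    have "((\<lambda>n. \<integral>\<^sup>+z. k z \<partial>proj_YS (\<gamma>s n)) \<longlongrightarrow> (\<integral>\<^sup>+z. k z \<partial>proj_YS \<gamma>)) G"
      using k measurable_cong_sets[OF sets_\<pi>(2) refl]
      by (intro nn_integral_tendsto_of_setwise[where N = \<pi>m] int)
         (auto simp: sets_proj sets_\<pi> dom_m lim_m)
    moreover have "(\<integral>\<^sup>+z\<in>A \<times> UNIV. k z \<partial>proj_YS \<gamma>) = (\<integral>\<^sup>+z\<in>A \<times> UNIV. k z \<partial>proj_XS \<gamma>)"
      if "A \<in> sets borel" for A
      by (rule balance_of_setwise_limit[OF G(1), where N = borel, OF sets_proj(2) sets_proj(2) sets_\<pi>(2)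
          sets_proj(1) sets_proj(1) sets_\<pi>(1) dom_m dom_p lim_m lim_p k int k_fin fin(1) value_eq[symmetric]
          cyl[OF that] bal_n[OF that, symmetric] bal_n'[OF that, symmetric]])
    ultimately show ?thesis
      by (simp add: value_proj sets_\<gamma> sets_\<gamma>s)
  qed
  then have lim_value: "(v \<longlongrightarrow> exchange_value c \<gamma>) G"
    and bal: "\<And>A. A \<in> sets borel \<Longrightarrow>
      (\<integral>\<^sup>+z\<in>A \<times> UNIV. k z \<partial>proj_XS \<gamma>) = (\<integral>\<^sup>+z\<in>A \<times> UNIV. k z \<partial>proj_YS \<gamma>)"
    unfolding ext[of v "\<lambda>n. exchange_value c (\<gamma>s n)", OF \<gamma>s(2)] by blast+
  \<comment> \<open>The increasing sequence \<open>v\<close> converges to the supremum along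
    \<open>sequentially\<close>, hence along the finer filter \<open>G\<close>, where limits are
    unique.\<close>
  have "(v \<longlongrightarrow> Sup ?V) G"
    unfolding v(3) using LIMSEQ_SUP[OF v(1)] G(2) by (rule tendsto_mono[rotated])
  then have opt: "exchange_value c \<gamma> = Sup ?V"
    using tendsto_unique[OF G(1) lim_value] by simp
  have "emeasure (proj_XS \<gamma>) B \<le> emeasure \<pi>p B" "emeasure (proj_YS \<gamma>) B \<le> emeasure \<pi>m B"
    if "B \<in> sets borel" for B
    using tendsto_upperbound[OF lim_p[OF that] _ G(1)] tendsto_upperbound[OF lim_m[OF that] _ G(1)]
      dom_p[OF that] dom_m[OF that] by simp_all
  then have "\<gamma> \<in> exchange_plans \<pi>p \<pi>m c"
    using \<gamma> bal nn_integral_proj[OF sets_\<gamma> k] by (simp add: exchange_plans_def k_def)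
  moreover have "exchange_value c \<gamma>' \<le> exchange_value c \<gamma>" if "\<gamma>' \<in> exchange_plans \<pi>p \<pi>m c" for \<gamma>'
    unfolding opt using that by (intro Sup_upper imageI)
  ultimately show ?thesis by blast
qed

end
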